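(* Let $n\ge1$ and $0\le i<n$. The total number of cells of height $n-i$ in all Motzkin polyominoes of length $n$ is equal to the trinomial coefficient $T(n,i)$, i.e. the coefficient of $x^i$ in the expansion of $(1+x+x^2)^n$.
   Context: A Motzkin word of length $n\ge 1$ is a word $w=w_1\cdots w_n$ over the positive integers such that $w_1=1$, and $1\le w_k\le w_{k-1}+1$ and $w_{k-1}\ne w_k$ for $k=2,\dots,n$. To $w$ one associates the Motzkin polyomino of length $n$ with $n$ columns, all bottom-justified, whose $j$-th column consists of $w_j$ unit cells stacked at heights $1,2,\dots,w_j$. A cell of height $h$ is a cell lying in the $h$-th row from the bottom (so the polyomino of $w$ has as many cells of height $h$ as there are indices $j$ with $w_j\ge h$). *)

theory Defs
  imports Main "HOL-Computational_Algebra.Polynomial"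
begin

text \<open>Words are lists, so the letter written w_k in the source is \<open>w ! (k - 1)\<close>.\<close>

definition motzkin_word :: "nat \<Rightarrow> nat list \<Rightarrow> bool" where
  "motzkin_word n w \<longleftrightarrow>
     1 \<le> n \<and> length w = n \<and> w ! 0 = 1 \<and>
     (\<forall>k\<in>{1..<n}. 1 \<le> w ! k \<and> w ! k \<le> w ! (k - 1) + 1 \<and> w ! (k - 1) \<noteq> w ! k)"

text \<open>A cell is a pair (column, height), both counted from 1.\<close>

definition bargraph :: "nat list \<Rightarrow> (nat \<times> nat) set" where
  "bargraph w = {(j, h). 1 \<le> j \<and> j \<le> length w \<and> 1 \<le> h \<and> h \<le> w ! (j - 1)}"

definition motzkin_polyominoes :: "nat \<Rightarrow> (nat \<times> nat) set set" where
  "motzkin_polyominoes n = bargraph ` {w. motzkin_word n w}"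

definition cells_of_height :: "nat \<Rightarrow> (nat \<times> nat) set \<Rightarrow> (nat \<times> nat) set" where
  "cells_of_height h P = {c \<in> P. snd c = h}"

definition trinomial_coeff :: "nat \<Rightarrow> nat \<Rightarrow> nat" where
  "trinomial_coeff n i = coeff ([:1, 1, 1:] ^ n) i"

end

theory Submission
  imports Defs "HOL-Computational_Algebra.Formal_Power_Series"
begin

text \<open>
  A word is a walk on the positive integers in which a step from \<open>m\<close> leads to \<open>m + 1\<close> or to any
  smaller positive integer. On the exponential \<open>m \<mapsto> u ^ m\<close>, summing over the possible steps
  multiplies by \<open>u + 1 / (u - 1)\<close>, up to the boundary term \<open>u / (u - 1)\<close>, which does not depend
  on \<open>m\<close>. For \<open>u = 1 + x\<close> the multiplier is \<open>1/x + 1 + x\<close>, that is \<open>P / x\<close> with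
  \<open>P = 1 + x + x^2\<close>: this is where the trinomial coefficients come from. The multiplier is
  invariant under \<open>x \<mapsto> 1/x\<close>, so \<open>u' = 1 + 1/x\<close> gives a second exponential with the same
  multiplier.

  Accordingly, quantities attached to walks of \<open>n\<close> steps starting at \<open>m\<close> are sought in the form
  \<open>[x^n] P^n F_m\<close>, written \<open>diag n (F m)\<close> below. A series identity \<open>P F = x G\<close> then expresses one
  step of the recursion in \<open>n\<close>.

  The number of walks is obtained with \<open>F_m = (1 + x)^m (1 - x)\<close> (\<open>card_walks\<close>). The
  number of letters \<open>\<ge> h\<close> in these walks, taken together, satisfies the same recursion with the number
  of walks as an inhomogeneity for \<open>m \<ge> h\<close> (\<open>letters_walks_Suc\<close>). It is \<open>[x^(n+1)] P^(n+1) H_m\<close> for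
  an explicit \<open>H_m\<close> (\<open>height_series\<close>, \<open>letters_walks\<close>), and \<open>H_1\<close> is just \<open>x^h\<close>. Words of length
  \<open>n\<close> are walks of \<open>n - 1\<close> steps from 1, and a letter \<open>\<ge> h\<close> is a column with a cell of height \<open>h\<close>;
  hence the number of cells of height \<open>h\<close> is \<open>[x^n] P^n x^h = T(n, n - h)\<close>.
\<close>

section \<open>Words as walks on the positive integers\<close>

definition steps :: "nat \<Rightarrow> nat set" where
  "steps m = {1..m + 1} - {m}"

text \<open>Walks have \<open>n\<close> steps, hence \<open>n + 1\<close> letters, so that no case of an empty word arises.\<close>

definition walks :: "nat \<Rightarrow> nat \<Rightarrow> nat list set" where
  "walks n m = {w. length w = Suc n \<and> w ! 0 = m \<and> (\<forall>k<n. w ! Suc k \<in> steps (w ! k))}"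

definition letters_at_least :: "nat \<Rightarrow> nat list \<Rightarrow> nat" where
  "letters_at_least h w = length (filter (\<lambda>l. h \<le> l) w)"

lemma finite_steps [simp]: "finite (steps m)"
  by (simp add: steps_def)

lemma sum_steps:
  fixes f :: "nat \<Rightarrow> 'a::comm_monoid_add"
  assumes "m \<ge> 1"
  shows "sum f (steps m) = sum f {1..<m} + f (Suc m)"
proof -
  have "steps m = insert (Suc m) {1..<m}"
    using assms by (auto simp: steps_def)
  then show ?thesis
    by (simp add: add.commute)
qed

lemma motzkin_word_iff_walk: "motzkin_word (Suc n) w \<longleftrightarrow> w \<in> walks n 1"
proof -
  have "(\<forall>k\<in>{1..<Suc n}. 1 \<le> w ! k \<and> w ! k \<le> w ! (k - 1) + 1 \<and> w ! (k - 1) \<noteq> w ! k)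
      \<longleftrightarrow> (\<forall>k<n. w ! Suc k \<in> steps (w ! k))" (is "?L \<longleftrightarrow> ?R")
  proof
    assume L: ?L
    show ?R
    proof (intro allI impI)
      fix k assume "k < n"
      with L[rule_format, of "Suc k"] show "w ! Suc k \<in> steps (w ! k)"
        by (auto simp: steps_def)
    qed
  next
    assume R: ?R
    show ?L
    proof
      fix k assume k: "k \<in> {1..<Suc n}"
      then have "k - 1 < n" "Suc (k - 1) = k"
        by auto
      with R[rule_format, of "k - 1"]
      show "1 \<le> w ! k \<and> w ! k \<le> w ! (k - 1) + 1 \<and> w ! (k - 1) \<noteq> w ! k"
        by (auto simp: steps_def)
    qed
  qed
  then show ?thesis
    by (auto simp: motzkin_word_def walks_def)
qed

lemma walks_0: "walks 0 m = {[m]}"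
  by (auto simp: walks_def length_Suc_conv)

lemma Cons_mem_walks:
  "a # v \<in> walks (Suc n) m \<longleftrightarrow> a = m \<and> (\<exists>k\<in>steps m. v \<in> walks n k)"
  by (auto simp: walks_def All_less_Suc2)

lemma walks_Suc: "walks (Suc n) m = (\<Union>k\<in>steps m. Cons m ` walks n k)"
proof (intro set_eqI)
  fix w
  show "w \<in> walks (Suc n) m \<longleftrightarrow> w \<in> (\<Union>k\<in>steps m. Cons m ` walks n k)"
  proof (cases w)
    case Nil
    then show ?thesis by (auto simp: walks_def)
  next
    case (Cons a v)
    then show ?thesis by (auto simp: Cons_mem_walks)
  qed
qed

lemma finite_walks [simp]: "finite (walks n m)"
  by (induction n arbitrary: m) (auto simp: walks_0 walks_Suc)

lemma sum_walks_Suc: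
  fixes f :: "nat list \<Rightarrow> 'a::comm_monoid_add"
  shows "(\<Sum>w\<in>walks (Suc n) m. f w) = (\<Sum>k\<in>steps m. \<Sum>v\<in>walks n k. f (m # v))"
proof -
  \<comment> \<open>The second letter tells the parts of the union apart.\<close>
  have "Cons m ` walks n k \<inter> Cons m ` walks n l = {}" if "k \<noteq> l" for k l
    using that by (auto simp: walks_def)
  then have "(\<Sum>w\<in>walks (Suc n) m. f w) = (\<Sum>k\<in>steps m. \<Sum>w\<in>Cons m ` walks n k. f w)"
    unfolding walks_Suc by (intro sum.UNION_disjoint) auto
  also have "\<dots> = (\<Sum>k\<in>steps m. \<Sum>v\<in>walks n k. f (m # v))"
    by (simp add: sum.reindex o_def)
  finally show ?thesis .
qed

lemma card_walks_Suc: "card (walks (Suc n) m) = (\<Sum>k\<in>steps m. card (walks n k))"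
  using sum_walks_Suc[of "\<lambda>_. 1::nat" n m] by simp

text \<open>The first letter contributes once for every walk if it is at least \<open>h\<close>; the other letters form
  a walk from one of the possible second letters.\<close>

lemma letters_walks_Suc:
  "(\<Sum>w\<in>walks (Suc n) m. letters_at_least h w)
     = (if h \<le> m then card (walks (Suc n) m) else 0)
       + (\<Sum>k\<in>steps m. \<Sum>v\<in>walks n k. letters_at_least h v)"
  by (simp add: sum_walks_Suc card_walks_Suc letters_at_least_def sum_Suc sum.distrib)

section \<open>Trinomial coefficients as coefficients of power series\<close>

definition trinom :: "rat fps" where
  "trinom = 1 + fps_X + fps_X ^ 2"

lemma fps_nth_trinom_mult:
  "fps_nth (trinom * f) i
     = fps_nth f i + (if i \<ge> 1 then fps_nth f (i - 1) else 0)
       + (if i \<ge> 2 then fps_nth f (i - 2) else 0)"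
  by (auto simp: trinom_def ring_distribs fps_X_power_mult_nth)

lemma fps_nth_trinom_power: "fps_nth (trinom ^ n) i = of_nat (trinomial_coeff n i)"
proof (induction n arbitrary: i)
  case 0
  then show ?case by (simp add: trinomial_coeff_def)
next
  case (Suc n)
  have "trinomial_coeff (Suc n) i = trinomial_coeff n i
      + (if i \<ge> 1 then trinomial_coeff n (i - 1) else 0)
      + (if i \<ge> 2 then trinomial_coeff n (i - 2) else 0)"
    by (auto simp: trinomial_coeff_def coeff_pCons numeral_2_eq_2 split: nat.splits)
  then show ?case
    by (simp add: fps_nth_trinom_mult Suc.IH)
qed

text \<open>The polynomial \<open>1 + x + x^2\<close> is palindromic, and so are its powers.\<close>

lemma trinomial_coeff_symmetric:
  assumes "i \<le> 2 * n"
  shows "trinomial_coeff n i = trinomial_coeff n (2 * n - i)"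
proof -
  define p :: "nat poly" where "p = [:1, 1, 1:]"
  have "reflect_poly p = p"
    by (simp add: p_def reflect_poly_def)
  then have "reflect_poly (p ^ n) = p ^ n"
    by (simp add: reflect_poly_power)
  moreover have "p \<noteq> 0" "degree p = 2"
    by (simp_all add: p_def)
  then have "degree (p ^ n) = 2 * n"
    by (induction n) (simp_all add: degree_mult_eq)
  ultimately have "coeff (p ^ n) i = coeff (p ^ n) (2 * n - i)"
    using assms coeff_reflect_poly[of "p ^ n" i] by simp
  then show ?thesis
    by (simp add: trinomial_coeff_def p_def)
qed

section \<open>The kernel of the walk\<close>

text \<open>This functional turns the generating function in \<open>n\<close> into a function of \<open>x\<close>: by Lagrange
  inversion, \<open>\<Sum>n. t^n * diag n F\<close> equals \<open>F(v) / (1 - t P'(v))\<close>, where \<open>v\<close> is the power series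
  in \<open>t\<close> with \<open>v = t P(v)\<close>.\<close>

definition diag :: "nat \<Rightarrow> rat fps \<Rightarrow> rat" where
  "diag n H = fps_nth (trinom ^ n * H) n"

lemma diag_add: "diag n (F + G) = diag n F + diag n G"
  and diag_diff: "diag n (F - G) = diag n F - diag n G"
  and diag_zero: "diag n 0 = 0"
  and diag_sum: "diag n (\<Sum>k\<in>A. f k) = (\<Sum>k\<in>A. diag n (f k))"
  by (simp_all add: diag_def ring_distribs fps_sum_nth sum_distrib_left)

lemma diag_Suc_eqI:
  assumes "trinom * F = fps_X * G"
  shows "diag (Suc n) F = diag n G"
proof -
  have "trinom ^ Suc n * F = fps_X * (trinom ^ n * G)"
    using arg_cong[OF assms, of "\<lambda>H. trinom ^ n * H"] by (simp add: mult_ac)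
  then show ?thesis by (simp add: diag_def del: power_Suc)
qed

text \<open>Transfers a recursion for walks to series. Passing from \<open>m\<close> to \<open>m + 1\<close> removes the possible next
  letter \<open>m + 1\<close> and adds \<open>m\<close> and \<open>m + 2\<close>, so the recursion at \<open>m + 1\<close> minus that at \<open>m\<close> is a
  relation with a bounded number of terms. Exponentials satisfy this relation exactly, since their
  boundary terms cancel; the boundary enters only at \<open>m = 1\<close>. There equality is required only after
  applying \<open>diag\<close>, because \<open>walk_series\<close> satisfies the recursion only in this weaker sense.\<close>

lemma diag_steps:
  fixes H S :: "nat \<Rightarrow> rat fps"
  assumes base: "diag (Suc n) (H 1) = diag n (S 1 + H 2)"
    and diff: "\<And>m. m \<ge> 1 \<Longrightarrow> trinom * (H (Suc m) - H m)
          = fps_X * (S (Suc m) - S m + H m + H (Suc (Suc m)) - H (Suc m))"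
    and "m \<ge> 1"
  shows "diag (Suc n) (H m) = diag n (S m) + (\<Sum>k\<in>steps m. diag n (H k))"
  using \<open>m \<ge> 1\<close>
proof (induction m rule: nat_induct_at_least)
  case base
  show ?case
    using assms(1) by (simp add: sum_steps diag_add numeral_2_eq_2)
next
  case (Suc m)
  have "diag (Suc n) (H (Suc m)) - diag (Suc n) (H m)
      = diag n (S (Suc m)) - diag n (S m) + diag n (H m)
        + diag n (H (Suc (Suc m))) - diag n (H (Suc m))"
    using diag_Suc_eqI[OF diff[OF Suc.hyps], of n] by (simp add: diag_add diag_diff)
  with Suc show ?case
    by (simp add: sum_steps)
qed

section \<open>Counting walks\<close>

text \<open>The exponential \<open>(1 + x)^m\<close> gives the multiplier \<open>P / x\<close>; the factor \<open>1 - x\<close> is chosen so that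
  the boundary term becomes \<open>(1 - x^2) / x\<close>, which is invisible to \<open>diag\<close> by the symmetry of the
  trinomial coefficients.\<close>

definition walk_series :: "nat \<Rightarrow> rat fps" where
  "walk_series m = (1 + fps_X) ^ m * (1 - fps_X)"

lemma diag_one_minus_square: "fps_nth (trinom ^ n * (1 - fps_X ^ 2)) (Suc n) = 0"
proof (cases n)
  case 0
  then show ?thesis by simp
next
  case (Suc k)
  have "trinomial_coeff n (Suc n) = trinomial_coeff n (n - 1)"
    using trinomial_coeff_symmetric[of "Suc n" n] Suc by simp
  then show ?thesis
    by (simp add: right_diff_distrib fps_X_power_mult_right_nth fps_nth_trinom_power Suc
        del: power_Suc)
qed

lemma walk_series_base: "diag (Suc n) (walk_series 1) = diag n (walk_series 2)"
proof -
  have "trinom * walk_series 1 = (1 - fps_X ^ 2) + fps_X * walk_series 2"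
    by (simp add: walk_series_def trinom_def algebra_simps power2_eq_square)
  from arg_cong[OF this, of "\<lambda>F. trinom ^ n * F"]
  have eq: "trinom ^ Suc n * walk_series 1
      = trinom ^ n * (1 - fps_X ^ 2) + fps_X * (trinom ^ n * walk_series 2)"
    by (simp add: distrib_left mult_ac del: One_nat_def)
  show ?thesis
    unfolding diag_def eq using diag_one_minus_square[of n] by simp
qed

lemma diag_Suc_walk_series:
  assumes "m \<ge> 1"
  shows "diag (Suc n) (walk_series m) = (\<Sum>k\<in>steps m. diag n (walk_series k))"
proof -
  have "diag (Suc n) (walk_series m)
      = diag n ((\<lambda>_. 0) m) + (\<Sum>k\<in>steps m. diag n (walk_series k))"
  proof (rule diag_steps[OF _ _ assms])
    show "diag (Suc n) (walk_series 1) = diag n (0 + walk_series 2)"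
      using walk_series_base by simp
  next
    fix m :: nat
    show "trinom * (walk_series (Suc m) - walk_series m)
        = fps_X * (0 - 0 + walk_series m + walk_series (Suc (Suc m)) - walk_series (Suc m))"
      by (simp add: walk_series_def trinom_def algebra_simps power2_eq_square)
  qed
  then show ?thesis by (simp add: diag_zero)
qed

lemma card_walks:
  assumes "m \<ge> 1"
  shows "of_nat (card (walks n m)) = diag n (walk_series m)"
  using assms
proof (induction n arbitrary: m)
  case 0
  then show ?case
    by (simp add: walks_0 diag_def walk_series_def fps_power_zeroth)
next
  case (Suc n)
  have "of_nat (card (walks (Suc n) m)) = (\<Sum>k\<in>steps m. diag n (walk_series k))"
    using Suc.IH by (simp add: card_walks_Suc steps_def)
  also have "\<dots> = diag (Suc n) (walk_series m)"
    using diag_Suc_walk_series[OF Suc.prems] by simp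
  finally show ?case .
qed

section \<open>Counting high letters\<close>

text \<open>Multiplying by this denominator turns the series \<open>height_series\<close> into polynomials, so that
  identities between them can be verified by expansion.\<close>

definition height_denom :: "rat fps" where
  "height_denom = (1 + fps_X) ^ 2 * (1 - fps_X)"

text \<open>Up to the common denominator, for \<open>m \<le> h\<close> this is \<open>x^(h + 1) * (u'^m - x * u^m)\<close> with
  \<open>u = 1 + x\<close> and \<open>u' = (1 + x) / x\<close>: the combination of the two exponentials whose boundary terms
  cancel. For \<open>m > h\<close> the exponential \<open>u'^m\<close> is excluded by its pole at \<open>x = 0\<close>, whose order grows
  with \<open>m\<close>. The inhomogeneity \<open>walk_series\<close> is itself a multiple of \<open>u^m\<close>, so it resonates and
  produces a term linear in \<open>m\<close>. The constants are fixed by requiring the two formulas to agree at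
  \<open>m = h\<close> and the recursion to hold there and just below.\<close>

definition height_series :: "nat \<Rightarrow> nat \<Rightarrow> rat fps" where
  "height_series h m =
     (if m \<le> h then fps_X ^ (Suc h - m) * (1 + fps_X) ^ m * (1 - fps_X ^ Suc m)
      else (1 + fps_X) ^ m * (of_nat (m - h) * fps_X ^ 2 * (1 - fps_X) + fps_X * (1 - fps_X ^ Suc h)))
     * inverse height_denom"

lemma height_denom_nth_0: "fps_nth height_denom 0 = 1"
  by (simp add: height_denom_def fps_power_zeroth)

lemma height_denom_nonzero: "height_denom \<noteq> 0"
  using height_denom_nth_0 by auto

lemma denom_mult_height_series_low:
  assumes "m \<le> h"
  shows "height_denom * height_series h m
    = fps_X ^ (Suc h - m) * (1 + fps_X) ^ m * (1 - fps_X ^ Suc m)"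
proof -
  have "height_denom * inverse height_denom = 1"
    by (rule inverse_mult_eq_1') (simp add: height_denom_nth_0)
  then show ?thesis
    using assms by (simp add: height_series_def mult.left_commute[of height_denom])
qed

text \<open>At \<open>m = h\<close> both formulas apply, which lets the recursion pass from one regime to the other.\<close>

lemma denom_mult_height_series_high:
  assumes "m \<ge> h"
  shows "height_denom * height_series h m
    = (1 + fps_X) ^ m * (of_nat (m - h) * fps_X ^ 2 * (1 - fps_X) + fps_X * (1 - fps_X ^ Suc h))"
proof (cases "m = h")
  case True
  then show ?thesis
    using denom_mult_height_series_low[of m h] by (simp add: mult_ac)
next
  case False
  have "height_denom * inverse height_denom = 1"
    by (rule inverse_mult_eq_1') (simp add: height_denom_nth_0)
  then show ?thesis
    using assms False by (simp add: height_series_def mult.left_commute[of height_denom])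
qed

lemma height_series_eqI: "height_denom * F = height_denom * G \<Longrightarrow> F = G"
  using height_denom_nonzero by simp

lemma height_series_nth_0: "fps_nth (height_series h m) 0 = 0"
  by (simp add: height_series_def)

text \<open>Since words start with the letter 1, this value is the source of the final formula.\<close>

lemma height_series_1:
  assumes "h \<ge> 1"
  shows "height_series h 1 = fps_X ^ h"
  by (rule height_series_eqI, subst denom_mult_height_series_low)
     (use assms in \<open>simp_all add: height_denom_def algebra_simps power2_eq_square\<close>)

text \<open>The contribution of the first letter to the number of letters \<open>\<ge> h\<close>.\<close>

definition high_walk_series :: "nat \<Rightarrow> nat \<Rightarrow> rat fps" where
  "high_walk_series h m = (if h \<le> m then walk_series m else 0)"

lemma height_series_base:
  assumes "h \<ge> 1"
  shows "trinom * height_series h 1 = fps_X * (high_walk_series h 1 + height_series h 2)"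
proof (cases "h = 1")
  case True
  have "height_denom * height_series 1 2
      = (1 + fps_X) ^ 2 * (fps_X ^ 2 * (1 - fps_X) + fps_X * (1 - fps_X ^ 2))"
    by (simp add: denom_mult_height_series_high numeral_2_eq_2)
  also have "\<dots> = height_denom * (fps_X + 2 * fps_X ^ 2)"
    by (simp add: height_denom_def algebra_simps power2_eq_square)
  finally have "height_series 1 2 = fps_X + 2 * fps_X ^ 2"
    by (rule height_series_eqI)
  then show ?thesis
    using True height_series_1[of h]
    by (simp add: high_walk_series_def walk_series_def trinom_def algebra_simps power2_eq_square)
next
  case False
  with assms obtain d where h: "h = d + 2"
    by (metis add.commute le_antisym less_one not_less_eq_eq Suc_1 le_Suc_ex)
  have "height_denom * height_series h 2
      = fps_X ^ Suc d * (1 + fps_X) ^ 2 * (1 - fps_X ^ 3)"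
    by (subst denom_mult_height_series_low) (simp_all add: h)
  also have "\<dots> = height_denom * (fps_X ^ Suc d * trinom)"
    by (simp add: height_denom_def trinom_def algebra_simps power2_eq_square power3_eq_cube)
  finally have "height_series h 2 = fps_X ^ Suc d * trinom"
    by (rule height_series_eqI)
  then show ?thesis
    using h height_series_1[of h] by (simp add: high_walk_series_def mult_ac)
qed

text \<open>The relation involves the starting points \<open>m\<close>, \<open>m + 1\<close> and \<open>m + 2\<close>. They lie on one side of
  \<open>h\<close>, where a single formula applies to all of them, unless \<open>h = m + 1\<close>. In that case the failure
  of the lower formula at \<open>m + 2\<close> is balanced by the walks starting at \<open>h\<close>.\<close>

lemma height_series_difference:
  "trinom * (height_series h (Suc m) - height_series h m)
     = fps_X * (high_walk_series h (Suc m) - high_walk_series h m + height_series h m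
                + height_series h (Suc (Suc m)) - height_series h (Suc m))"
proof (rule height_series_eqI)
  define A where "A = (\<lambda>m. height_denom * height_series h m)"
  define B where "B = (\<lambda>m. height_denom * high_walk_series h m)"
  consider (below) d where "h = Suc (Suc m) + d" | (cross) "h = Suc m"
    | (above) d where "m = h + d"
    by (metis le_Suc_ex not_less_eq_eq le_antisym)
  then have "trinom * (A (Suc m) - A m)
      = fps_X * (B (Suc m) - B m + A m + A (Suc (Suc m)) - A (Suc m))"
  proof cases
    case below
    have "A m = fps_X ^ (d + 3) * (1 + fps_X) ^ m * (1 - fps_X ^ Suc m)"
      "A (Suc m) = fps_X ^ (d + 2) * (1 + fps_X) ^ Suc m * (1 - fps_X ^ Suc (Suc m))"
      "A (Suc (Suc m)) = fps_X ^ (d + 1) * (1 + fps_X) ^ Suc (Suc m) * (1 - fps_X ^ Suc (Suc (Suc m)))"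
      unfolding A_def by (simp_all add: below denom_mult_height_series_low eval_nat_numeral)
    moreover have "B m = 0" "B (Suc m) = 0"
      by (simp_all add: B_def high_walk_series_def below)
    ultimately show ?thesis
      by (simp only:) (simp add: trinom_def algebra_simps power2_eq_square eval_nat_numeral)
  next
    case cross
    have "A m = fps_X ^ 2 * (1 + fps_X) ^ m * (1 - fps_X ^ Suc m)"
      "A (Suc m) = fps_X * (1 + fps_X) ^ Suc m * (1 - fps_X ^ Suc (Suc m))"
      "A (Suc (Suc m)) = (1 + fps_X) ^ Suc (Suc m)
         * (fps_X ^ 2 * (1 - fps_X) + fps_X * (1 - fps_X ^ Suc (Suc m)))"
      unfolding A_def
      by (simp_all add: cross denom_mult_height_series_low denom_mult_height_series_high
          eval_nat_numeral)
    moreover have "B m = 0" "B (Suc m) = height_denom * walk_series (Suc m)"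
      by (simp_all add: B_def high_walk_series_def cross)
    ultimately show ?thesis
      by (simp only:) (simp add: trinom_def height_denom_def walk_series_def algebra_simps power2_eq_square)
  next
    case above
    have A: "A (h + k) = (1 + fps_X) ^ (h + k)
        * (of_nat k * fps_X ^ 2 * (1 - fps_X) + fps_X * (1 - fps_X ^ Suc h))" for k
      unfolding A_def by (simp add: denom_mult_height_series_high)
    have B: "B (h + k) = height_denom * walk_series (h + k)" for k
      by (simp add: B_def high_walk_series_def)
    show ?thesis
      unfolding above add_Suc_right[symmetric] A B
      by (simp add: trinom_def height_denom_def walk_series_def algebra_simps power2_eq_square)
  qed
  then show "height_denom * (trinom * (height_series h (Suc m) - height_series h m))
     = height_denom * (fps_X * (high_walk_series h (Suc m) - high_walk_series h m
         + height_series h m + height_series h (Suc (Suc m)) - height_series h (Suc m)))"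
    unfolding A_def B_def by (simp add: algebra_simps)
qed

lemma diag_Suc_height_series:
  assumes "h \<ge> 1" "m \<ge> 1"
  shows "diag (Suc n) (height_series h m)
    = diag n (high_walk_series h m) + (\<Sum>k\<in>steps m. diag n (height_series h k))"
  using assms(2)
  by (intro diag_steps height_series_difference diag_Suc_eqI height_series_base assms(1))

text \<open>The exponent is \<open>n + 1\<close>, the number of letters. The base case uses that the series \<open>height_series\<close>
  have constant term 0, as the empty word has no letters.\<close>

lemma letters_walks:
  assumes "h \<ge> 1" "m \<ge> 1"
  shows "of_nat (\<Sum>w\<in>walks n m. letters_at_least h w) = diag (Suc n) (height_series h m)"
  using assms(2)
proof (induction n arbitrary: m)
  case 0
  have "diag (Suc 0) (height_series h m) = diag 0 (high_walk_series h m)"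
    using diag_Suc_height_series[OF assms(1) 0, of 0] by (simp add: diag_def height_series_nth_0)
  also have "\<dots> = (if h \<le> m then 1 else 0)"
    using card_walks[OF 0, of 0] by (simp add: high_walk_series_def walks_0 diag_zero)
  finally show ?case
    by (simp add: walks_0 letters_at_least_def)
next
  case (Suc n)
  have "(\<Sum>k\<in>steps m. of_nat (\<Sum>w\<in>walks n k. letters_at_least h w))
      = (\<Sum>k\<in>steps m. diag (Suc n) (height_series h k))"
    by (rule sum.cong[OF refl Suc.IH]) (simp add: steps_def)
  then have "of_nat (\<Sum>w\<in>walks (Suc n) m. letters_at_least h w)
      = diag (Suc n) (high_walk_series h m) + (\<Sum>k\<in>steps m. diag (Suc n) (height_series h k))"
    using card_walks[OF Suc.prems, of "Suc n"]
    by (simp add: letters_walks_Suc high_walk_series_def diag_zero)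
  also have "\<dots> = diag (Suc (Suc n)) (height_series h m)"
    using diag_Suc_height_series[OF assms(1) Suc.prems, of "Suc n"] by simp
  finally show ?case .
qed

section \<open>Cells of polyominoes\<close>

text \<open>Distinct words of the same length have distinct polyominoes, so a sum over polyominoes is a sum over
  words. The length is needed because a bargraph does not record trailing zeros.\<close>

lemma inj_on_bargraph: "inj_on bargraph {w. length w = n}"
proof (rule inj_onI, clarify)
  fix w v :: "nat list"
  assume len: "length v = length w" and eq: "bargraph w = bargraph v"
  have column: "h \<le> w ! j \<longleftrightarrow> h \<le> v ! j" if "j < length w" for j h
  proof (cases "h = 0")
    case False
    with eq that len have "(Suc j, h) \<in> bargraph w \<longleftrightarrow> (Suc j, h) \<in> bargraph v"
      by simp
    with False that len show ?thesis
      by (simp add: bargraph_def)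
  qed simp
  show "w = v"
  proof (rule nth_equalityI)
    fix j assume "j < length w"
    then show "w ! j = v ! j"
      using column[of j "w ! j"] column[of j "v ! j"] by simp
  qed (simp add: len)
qed

lemma card_cells_bargraph:
  assumes "h \<ge> 1"
  shows "card (cells_of_height h (bargraph w)) = letters_at_least h w"
proof -
  have "cells_of_height h (bargraph w) = (\<lambda>j. (Suc j, h)) ` {j. j < length w \<and> h \<le> w ! j}"
  proof (intro set_eqI iffI)
    fix c assume "c \<in> cells_of_height h (bargraph w)"
    then obtain j where "c = (j, h)" "1 \<le> j" "j \<le> length w" "h \<le> w ! (j - 1)"
      by (auto simp: cells_of_height_def bargraph_def)
    then show "c \<in> (\<lambda>j. (Suc j, h)) ` {j. j < length w \<and> h \<le> w ! j}"
      by (intro image_eqI[of _ _ "j - 1"]) auto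
  qed (use assms in \<open>auto simp: cells_of_height_def bargraph_def\<close>)
  then show ?thesis
    by (simp add: card_image inj_on_def letters_at_least_def length_filter_conv_card)
qed

theorem theorem5p7:
  fixes n i :: nat
  assumes "n \<ge> 1" and "i < n"
  shows "(\<Sum>P\<in>motzkin_polyominoes n. card (cells_of_height (n - i) P)) = trinomial_coeff n i"
proof -
  define h where "h = n - i"
  have h: "h \<ge> 1" "h \<le> n" "n - h = i"
    using assms by (auto simp: h_def)
  obtain k where n: "n = Suc k"
    using assms(1) by (cases n) auto
  have words: "{w. motzkin_word n w} = walks k 1"
    by (auto simp: n motzkin_word_iff_walk)
  have inj: "inj_on bargraph (walks k 1)"
    by (rule inj_on_subset[OF inj_on_bargraph[of "Suc k"]]) (auto simp: walks_def)
  have "(\<Sum>P\<in>motzkin_polyominoes n. card (cells_of_height h P))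
      = (\<Sum>w\<in>walks k 1. letters_at_least h w)"
    using inj
    by (simp add: motzkin_polyominoes_def words sum.reindex card_cells_bargraph[OF h(1)]
        del: One_nat_def)
  moreover have "of_nat (\<Sum>w\<in>walks k 1. letters_at_least h w) = (of_nat (trinomial_coeff n i) :: rat)"
  proof -
    have "of_nat (\<Sum>w\<in>walks k 1. letters_at_least h w) = diag n (height_series h 1)"
      using letters_walks[OF h(1), of 1 k] n by simp
    also have "\<dots> = fps_nth (trinom ^ n) (n - h)"
      using h unfolding height_series_1[OF h(1)]
      by (simp add: diag_def fps_X_power_mult_right_nth)
    finally show ?thesis
      by (simp add: fps_nth_trinom_power h)
  qed
  ultimately show ?thesis
    by (simp only: h_def of_nat_eq_iff)
qed

end
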